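(* Suppose that $f \in \mathfrak F$ and that $\alpha = a/q$, with $a \in \mathbb Z$, $q \in \mathbb Z^+$, and $\gcd(a,q) = 1$. The series \[ \sum_{n=1}^{\infty} (-1)^n f(n)\,|\sin(n\pi\alpha)| \] converges if and only if $q$ is odd.
   Context: $\mathfrak F$ denotes the class of continuous, decreasing functions $f : [1,\infty) \to \mathbb R$ such that $\lim_{x\to\infty} f(x) = 0$ and $\int_1^\infty f(x)\,dx = \infty$. *)

theory Defs
  imports "HOL-Analysis.Analysis"
begin

text \<open>
  A function on \<open>[1, \<infinity>)\<close> is a total function on \<open>real\<close> of which only the values on \<open>{1..}\<close> matter.
  ``Decreasing'' is read in the weak sense. The divergent integral is the improper one,
  the limit over \<open>[1, X]\<close> as \<open>X\<close> tends to infinity.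
\<close>

definition frakF :: "(real \<Rightarrow> real) set" where
  "frakF = {f. continuous_on {1..} f \<and> antimono_on {1..} f \<and> (f \<longlongrightarrow> 0) at_top \<and>
               filterlim (\<lambda>X. integral {1..X} f) at_top at_top}"

end

theory Submission
  imports Defs "HOL-Number_Theory.Cong"
begin

text \<open>
  For \<open>\<alpha> = a / q\<close> the coefficients \<open>c n = (-1) ^ n * \<bar>sin (n * pi * \<alpha>)\<bar>\<close> are periodic, and such a
  coefficient sequence is the sum of its mean over a period and a periodic sequence of mean zero.
  The part of mean zero has bounded partial sums, so by Dirichlet's test it contributes a convergent
  series. The constant part contributes the mean times \<open>\<Sum> f n\<close>, and \<open>\<Sum> f n\<close> diverges by the
  integral test. Hence the series converges exactly when the coefficients sum to zero over a period
  (\<open>summable_mult_periodic_iff\<close>), and everything comes down to that sum.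

  Moving \<open>n\<close> by \<open>q\<close> changes the argument of the sine by \<open>a * pi\<close>, which its absolute value does not
  see, so \<open>c (n + q) = (-1) ^ q * c n\<close>. If \<open>q\<close> is odd, the two halves of the period \<open>2 * q\<close> cancel.
  If \<open>q\<close> is even, then \<open>q\<close> is a period and \<open>a\<close> is odd; the map \<open>n \<mapsto> a * n\<close> permutes the residues
  modulo \<open>q\<close> and preserves their parity, so the numerator can be replaced by \<open>1\<close> and the sum over a
  period is \<open>\<Sum>m<q. (-1) ^ m * sin (m * pi / q) = - tan (pi / (2 * q))\<close>, which is not zero
  (\<open>period_sum_even_denominator\<close>).
\<close>

section \<open>Series with periodic coefficients\<close>

lemma sum_mult_by_parts:
  fixes u c :: "nat \<Rightarrow> 'a::comm_ring_1"
  shows "(\<Sum>k<n. u k * c k) =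
           u n * (\<Sum>k<n. c k) + (\<Sum>k<n. (u k - u (Suc k)) * (\<Sum>j<Suc k. c j))"
  by (induction n) (simp_all add: algebra_simps)

text \<open>
  After summation by parts the boundary term is a null sequence times a bounded one, and the
  remaining series is dominated by \<open>B\<close> times the telescoping series of the nonnegative decrements
  of \<open>u\<close>.
\<close>

lemma summable_Dirichlet:
  fixes u c :: "nat \<Rightarrow> real"
  assumes "decseq u" "u \<longlonglongrightarrow> 0" and bound: "\<And>n. \<bar>\<Sum>k<n. c k\<bar> \<le> B"
  shows "summable (\<lambda>k. u k * c k)"
proof -
  let ?S = "\<lambda>n. \<Sum>k<n. c k"
  have "summable (\<lambda>k. u k - u (Suc k))"
    using telescope_summable'[OF assms(2)] .
  then have "summable (\<lambda>k. B * (u k - u (Suc k)))"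
    by (rule summable_mult)
  then have "summable (\<lambda>k. (u k - u (Suc k)) * ?S (Suc k))"
  proof (rule summable_comparison_test', simp only: real_norm_def)
    fix k
    have "0 \<le> u k - u (Suc k)"
      using assms(1) by (simp add: decseq_SucD)
    then show "\<bar>(u k - u (Suc k)) * ?S (Suc k)\<bar> \<le> B * (u k - u (Suc k))"
      using mult_right_mono[OF bound[of "Suc k"]]
      by (simp only: abs_mult abs_of_nonneg mult.commute[of "u k - u (Suc k)"])
  qed
  then have "convergent (\<lambda>n. \<Sum>k<n. (u k - u (Suc k)) * ?S (Suc k))"
    by (simp add: summable_iff_convergent)
  moreover have "(\<lambda>n. u n * ?S n) \<longlonglongrightarrow> 0"
    using assms(2) by (rule lim_null_mult_right_bounded[where B = B]) (simp add: bound)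
  ultimately have "convergent (\<lambda>n. u n * ?S n + (\<Sum>k<n. (u k - u (Suc k)) * ?S (Suc k)))"
    by (intro convergent_add) (auto simp: convergent_def)
  then show ?thesis
    unfolding summable_iff_convergent by (subst sum_mult_by_parts)
qed

lemma sum_lessThan_add:
  fixes c :: "nat \<Rightarrow> 'a::comm_monoid_add"
  shows "(\<Sum>k<m + n. c k) = (\<Sum>k<m. c k) + (\<Sum>k<n. c (k + m))"
  by (induction n) (simp_all add: ac_simps)

text \<open>
  Full periods contribute nothing, so every partial sum equals one that stops within the first
  period.
\<close>

lemma periodic_sum_bounded:
  fixes c :: "nat \<Rightarrow> real"
  assumes "P > 0" and periodic: "\<And>k. c (k + P) = c k" and zero: "(\<Sum>k<P. c k) = 0"
  shows "\<bar>\<Sum>k<n. c k\<bar> \<le> (\<Sum>k<P. \<bar>c k\<bar>)"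
proof (induction n rule: less_induct)
  case (less n)
  show ?case
  proof (cases "n < P")
    case True
    have "\<bar>\<Sum>k<n. c k\<bar> \<le> (\<Sum>k<n. \<bar>c k\<bar>)"
      by (rule sum_abs)
    also have "\<dots> \<le> (\<Sum>k<P. \<bar>c k\<bar>)"
      using True by (intro sum_mono2) auto
    finally show ?thesis .
  next
    case False
    then have "(\<Sum>k<n. c k) = (\<Sum>k<n - P. c k)"
      using sum_lessThan_add[of c P "n - P"] zero by (simp add: periodic)
    then show ?thesis
      using less[of "n - P"] False assms(1) by simp
  qed
qed

text \<open>
  Subtracting the mean \<open>m\<close> from \<open>c\<close> changes the series by \<open>m * (\<Sum>k. u k)\<close>, while the series with
  centred coefficients converges by Dirichlet's test.
\<close>

lemma summable_mult_periodic_iff: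
  fixes u c :: "nat \<Rightarrow> real"
  assumes u: "decseq u" "u \<longlonglongrightarrow> 0" "\<not> summable u"
    and P: "P > 0" "\<And>k. c (k + P) = c k"
  shows "summable (\<lambda>k. u k * c k) \<longleftrightarrow> (\<Sum>k<P. c k) = 0"
proof -
  define m where "m = (\<Sum>k<P. c k) / P"
  have "(\<Sum>k<P. c k - m) = 0"
    using P(1) by (simp add: sum_subtractf m_def)
  then have centred: "summable (\<lambda>k. u k * (c k - m))"
    using periodic_sum_bounded[of P "\<lambda>k. c k - m"] P u(1,2)
    by (intro summable_Dirichlet[where c = "\<lambda>k. c k - m"]) auto
  have "summable (\<lambda>k. u k * c k) \<longleftrightarrow> summable (\<lambda>k. m * u k)"
    using summable_diff[OF _ centred, of "\<lambda>k. u k * c k"] summable_add[OF _ centred, of "\<lambda>k. m * u k"]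
    by (auto simp: algebra_simps)
  also have "\<dots> \<longleftrightarrow> m = 0"
    using u(3) by (simp add: summable_cmult_iff)
  also have "\<dots> \<longleftrightarrow> (\<Sum>k<P. c k) = 0"
    using P(1) by (simp add: m_def)
  finally show ?thesis .
qed

section \<open>The integral test for the class \<open>frakF\<close>\<close>

lemma frakF_sequence:
  assumes "f \<in> frakF"
  defines "u \<equiv> \<lambda>k. f (real (Suc k))"
  shows "decseq u" "u \<longlonglongrightarrow> 0" "\<not> summable u"
proof -
  have cont: "continuous_on {1..} f" and dec: "\<And>x y. 1 \<le> x \<Longrightarrow> x \<le> y \<Longrightarrow> f y \<le> f x"
    and lim: "(f \<longlongrightarrow> 0) at_top" and int: "filterlim (\<lambda>X. integral {1..X} f) at_top at_top"
    using assms(1) by (auto simp: frakF_def monotone_on_def)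
  show "decseq u"
    unfolding u_def decseq_def by (auto intro: dec)
  have real_Suc: "filterlim (\<lambda>k. real (Suc k)) at_top sequentially"
    by (rule filterlim_compose[OF filterlim_real_sequentially filterlim_Suc])
  show "u \<longlonglongrightarrow> 0"
    unfolding u_def by (rule filterlim_compose[OF lim real_Suc])
  \<comment> \<open>A decreasing function is bounded below by its limit at infinity.\<close>
  have nonneg: "0 \<le> f x" if "1 \<le> x" for x
    using lim by (rule tendsto_upperbound)
      (use that in \<open>auto simp: eventually_at_top_linorder intro: dec\<close>)
  \<comment> \<open>The integral test is stated for functions on the half-line from \<open>0\<close>, hence the translation by \<open>1\<close>.\<close>
  interpret antimono_fun_sum_integral_diff "\<lambda>x. f (x + 1)"
    by unfold_locales
      (auto intro!: dec nonneg continuous_on_compose2[OF cont] continuous_intros)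
  have "integral {0..real n} (\<lambda>x. f (x + 1)) = integral {1..real (Suc n)} f" for n
    using integral_shift_real_ivl[of 1 1 "real (Suc n)" f] by simp
  moreover have "\<not> convergent (\<lambda>n. integral {1..real (Suc n)} f)"
    using filterlim_at_top_imp_at_infinity[OF filterlim_compose[OF int real_Suc]]
      not_tendsto_and_filterlim_at_infinity[OF sequentially_bot]
    unfolding convergent_def by blast
  ultimately show "\<not> summable u"
    using integral_test by (simp add: u_def add.commute)
qed

section \<open>The sum of the coefficients over a period\<close>

lemma abs_sin_add_int_pi: "\<bar>sin (x + pi * of_int n)\<bar> = \<bar>sin x\<bar>"
  by (simp add: sin_add abs_mult)

text \<open>
  By \<open>2 * cos (\<theta> / 2) * sin (m * \<theta>) = sin ((m + 1 / 2) * \<theta>) + sin ((m - 1 / 2) * \<theta>)\<close> the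
  alternating sum telescopes.
\<close>

lemma alternating_sin_sum:
  fixes \<theta> :: real
  shows "2 * cos (\<theta> / 2) * (\<Sum>m<n. (-1) ^ m * sin (real m * \<theta>)) =
           - sin (\<theta> / 2) - (-1) ^ n * sin ((real n - 1 / 2) * \<theta>)"
proof (induction n)
  case (Suc n)
  have "2 * cos (\<theta> / 2) * sin (real n * \<theta>) =
          sin ((real n + 1 / 2) * \<theta>) + sin ((real n - 1 / 2) * \<theta>)"
    by (simp add: ring_distribs sin_add sin_diff)
  then have "2 * cos (\<theta> / 2) * ((-1) ^ n * sin (real n * \<theta>)) =
          (-1) ^ n * (sin ((real n + 1 / 2) * \<theta>) + sin ((real n - 1 / 2) * \<theta>))"
    by (metis mult.left_commute)
  with Suc show ?case
    by (simp add: algebra_simps)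
qed simp

text \<open>
  At \<open>\<theta> = pi / q\<close> both boundary terms of the telescoped sum equal \<open>- sin (\<theta> / 2)\<close>, so the sum is
  \<open>- tan (\<theta> / 2)\<close>.
\<close>

lemma even_alternating_sin_sum_neg:
  assumes "q > 0" "even q"
  shows "(\<Sum>m<q. (-1) ^ m * sin (real m * (pi / q))) < 0"
proof -
  let ?\<theta> = "pi / real q"
  have "real q \<ge> 2"
    using assms by (auto elim!: evenE)
  then have \<theta>: "0 < ?\<theta> / 2" "?\<theta> / 2 < pi / 2"
    by (auto simp: field_simps)
  have "(real q - 1 / 2) * ?\<theta> = pi - ?\<theta> / 2"
    using assms(1) by (simp add: field_simps)
  then have "2 * cos (?\<theta> / 2) * (\<Sum>m<q. (-1) ^ m * sin (real m * ?\<theta>)) = - 2 * sin (?\<theta> / 2)"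
    using assms(2) by (simp only: alternating_sin_sum) simp
  moreover have "sin (?\<theta> / 2) > 0" "cos (?\<theta> / 2) > 0"
    using \<theta> by (auto intro!: sin_gt_zero cos_gt_zero)
  ultimately show ?thesis
    by (smt (verit) zero_le_mult_iff)
qed

text \<open>
  Multiplication by a unit permutes the residues modulo \<open>q\<close>. The left-hand side runs over
  \<open>1, \<dots>, q\<close> instead of \<open>0, \<dots>, q - 1\<close> to match a series that starts at \<open>n = 1\<close>; both are complete
  systems of residues.
\<close>

lemma sum_mult_coprime_residues:
  fixes h :: "int \<Rightarrow> 'a::comm_monoid_add"
  assumes "q > 0" "coprime a (int q)" and h: "\<And>n. h (n mod int q) = h n"
  shows "(\<Sum>k<q. h (a * int (Suc k))) = (\<Sum>m<q. h (int m))"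
proof -
  let ?r = "\<lambda>k. nat (a * int (Suc k) mod int q)"
  have "inj_on ?r {..<q}"
  proof (rule inj_onI)
    fix i j assume ij: "i \<in> {..<q}" "j \<in> {..<q}" "?r i = ?r j"
    then have "[a * int (Suc i) = a * int (Suc j)] (mod int q)"
      using assms(1) by (simp add: cong_def nat_eq_iff)
    then have "[int (Suc i) = int (Suc j)] (mod int q)"
      using assms(2) by (simp add: cong_mult_lcancel)
    then have "[i + 1 = j + 1] (mod q)"
      by (simp only: cong_int_iff Suc_eq_plus1)
    then show "i = j"
      using ij by (auto simp only: cong_add_rcancel_nat cong_less_modulus_unique_nat lessThan_iff)
  qed
  moreover have "?r ` {..<q} \<subseteq> {..<q}"
    using assms(1) by (auto simp: nat_less_iff)
  ultimately have "bij_betw ?r {..<q} {..<q}"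
    by (simp add: bij_betw_def endo_inj_surj)
  then have "(\<Sum>m<q. h (int m)) = (\<Sum>k<q. h (int (?r k)))"
    by (rule sum.reindex_bij_betw[symmetric])
  also have "\<dots> = (\<Sum>k<q. h (a * int (Suc k)))"
    using assms(1) by (simp only: h int_nat_eq) (simp add: h)
  finally show ?thesis ..
qed

text \<open>
  Since \<open>a\<close> is odd, \<open>(-1) ^ n = (-1) ^ (a * n)\<close>, so the summand is a function \<open>h\<close> of the integer
  \<open>a * n\<close>. As \<open>q\<close> is even, reduction modulo \<open>q\<close> preserves parity and \<open>h\<close> depends only on the residue
  of \<open>a * n\<close>; on the residues \<open>0, \<dots>, q - 1\<close> the sine is nonnegative and the absolute value drops out.
\<close>

lemma period_sum_even_denominator:
  assumes "q > 0" "even q" "coprime a (int q)"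
  shows "(\<Sum>k<q. (-1) ^ Suc k * \<bar>sin (real (Suc k) * pi * (of_int a / real q))\<bar>) < 0"
proof -
  define h :: "int \<Rightarrow> real"
    where "h n = (if even n then 1 else -1) * \<bar>sin (of_int n * (pi / q))\<bar>" for n
  have "odd a"
    using assms(2,3) by (metis coprime_common_divisor even_of_nat odd_one)
  then have "(-1) ^ Suc k * \<bar>sin (real (Suc k) * pi * (of_int a / real q))\<bar> = h (a * int (Suc k))" for k
    by (auto simp: h_def ac_simps)
  moreover have "h (n mod int q) = h n" for n
  proof -
    have "real_of_int n = of_int (n mod int q) + of_int (n div int q) * real q"
      by (metis mod_div_mult_eq of_int_add of_int_mult of_int_of_nat_eq)
    then have "of_int n * (pi / q) = of_int (n mod int q) * (pi / q) + pi * of_int (n div int q)"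
      using assms(1) by (simp add: field_simps)
    moreover have "even (n mod int q) \<longleftrightarrow> even n"
      using assms(2) by (simp add: dvd_mod_iff)
    ultimately show ?thesis
      by (simp add: h_def abs_sin_add_int_pi)
  qed
  moreover have "h (int m) = (-1) ^ m * sin (real m * (pi / q))" if "m < q" for m
  proof -
    have "0 \<le> sin (real m * (pi / q))"
      using that by (intro sin_ge_zero) (auto simp: field_simps)
    then show ?thesis
      by (auto simp: h_def)
  qed
  ultimately show ?thesis
    using sum_mult_coprime_residues[OF assms(1,3), of h] even_alternating_sin_sum_neg[OF assms(1,2)]
    by simp
qed

lemma antiperiodic_sum_eq_0:
  fixes c :: "nat \<Rightarrow> real"
  assumes "\<And>k. c (k + q) = - c k"
  shows "(\<Sum>k<q + q. c k) = 0"
  using assms by (simp add: sum_lessThan_add sum_negf)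

theorem theorem1:
  fixes f :: "real \<Rightarrow> real" and \<alpha> :: real and a :: int and q :: nat
  assumes "f \<in> frakF"
    and "q > 0"
    and "coprime a (int q)"
    and "\<alpha> = of_int a / of_nat q"
  shows "summable (\<lambda>k. (-1) ^ Suc k * f (real (Suc k)) * \<bar>sin (real (Suc k) * pi * \<alpha>)\<bar>)
         \<longleftrightarrow> odd q"
proof -
  define c where "c k = (-1) ^ Suc k * \<bar>sin (real (Suc k) * pi * \<alpha>)\<bar>" for k
  have shift: "c (k + q) = (-1) ^ q * c k" for k
  proof -
    have "real (Suc (k + q)) * pi * \<alpha> = real (Suc k) * pi * \<alpha> + pi * of_int a"
      using assms(2,4) by (simp add: field_simps)
    then show ?thesis
      by (simp only: c_def abs_sin_add_int_pi) (simp add: power_add)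
  qed
  have "summable (\<lambda>k. (-1) ^ Suc k * f (real (Suc k)) * \<bar>sin (real (Suc k) * pi * \<alpha>)\<bar>)
          \<longleftrightarrow> summable (\<lambda>k. f (real (Suc k)) * c k)"
    by (simp add: c_def mult_ac)
  also have "\<dots> \<longleftrightarrow> odd q"
  proof (cases "even q")
    case True
    then have "(\<Sum>k<q. c k) < 0"
      unfolding c_def assms(4) using period_sum_even_denominator[OF assms(2) _ assms(3)] by blast
    then show ?thesis
      using summable_mult_periodic_iff[OF frakF_sequence[OF assms(1)], of q c] shift True assms(2)
      by simp
  next
    case False
    then have "c (k + q) = - c k" for k
      by (simp add: shift)
    moreover from this have "c (k + (q + q)) = c k" for k
      by (metis add.assoc minus_minus)
    ultimately show ?thesis
      using summable_mult_periodic_iff[OF frakF_sequence[OF assms(1)], of "q + q" c]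
        antiperiodic_sum_eq_0[of c q] False assms(2)
      by simp
  qed
  finally show ?thesis .
qed

end
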